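(* Let $\lambda>0$ be a real constant. For every integer $n\ge 1$, the system of ordinary differential equations $$\dot{x}=x^2-xy+\lambda z^2+n-1,\qquad \dot{y}=xy-nx^2+\lambda z^2,\qquad \dot{z}=xz$$ (corresponding to the rotationally symmetric, expanding gradient Ricci soliton on $\mathbb{R}^{n+1}$) does not pass the weak Painlevé test, and therefore does not pass the strong Painlevé test.
   Context: The independent variable $t$ is taken to be complex and the dot denotes $d/dt$. A system of $d$ first-order autonomous ODEs in $d$ unknown functions passes the weak Painlevé test if it admits a family of solutions with a movable singularity that are meromorphic in some rational power of the variable and have a full set of free parameters. That is: for some positive integer $Q$ there is a family of solutions given, near a point $t_0\in\mathbb{C}$, by series in powers of $(t-t_0)^{1/Q}$ with finitely many negative powers and with leading exponents fixed throughout the family, convergent in a punctured neighborhood of $t_0$ (on a branch of $(t-t_0)^{1/Q}$), with at least one component having a negative leading exponent, and the family depends on $d$ free parameters. The position $t_0$ of the singularity counts as one free parameter. The remaining free parameters are coefficients of the expansions that can be chosen arbitrarily (a leading coefficient being required to be nonzero) and independently when the series are substituted into the system and the coefficients are solved for recursively; all other coefficients are determined by these, up to finitely many choices. The system passes the strong Painlevé test if such a family exists with $Q=1$ (ordinary Laurent series, i.e. meromorphic solutions). Here $d=3$. *)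

theory Defs
  imports "HOL-Analysis.Analysis"
begin

text \<open>
  A branch of \<open>(t - t0)\<^sup>1\<^sup>/\<^sup>Q\<close> on an open set \<open>S\<close>. For \<open>Q = 1\<close> the only branch is
  \<open>t - t0\<close>, and \<open>S\<close> may then be a whole punctured disc.
\<close>

definition root_branch ::
    "nat \<Rightarrow> complex \<Rightarrow> complex set \<Rightarrow> (complex \<Rightarrow> complex) \<Rightarrow> bool" where
  "root_branch Q t0 S g \<longleftrightarrow>
     open S \<and> continuous_on S g \<and> (\<forall>t\<in>S. g t ^ Q = t - t0)"

text \<open>
  With \<open>w\<close> standing for \<open>(t - t0)\<^sup>1\<^sup>/\<^sup>Q\<close>, component \<open>i\<close> of a candidate solution is the series of
  all \<open>u i j * w powi (k i + j)\<close>, \<open>j = 0, 1, \<dots>\<close>. Its leading exponent in powers of \<open>w\<close> is the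
  integer \<open>k i\<close> and its leading coefficient is \<open>u i 0\<close>.
\<close>

definition puiseux_vec ::
    "('d \<Rightarrow> int) \<Rightarrow> ('d \<Rightarrow> nat \<Rightarrow> complex) \<Rightarrow> complex \<Rightarrow> complex ^ 'd" where
  "puiseux_vec k u w = (\<chi> i. \<Sum>j. u i j * w powi (k i + int j))"

text \<open>
  The series converge in a punctured disc around \<open>t0\<close> and solve the autonomous system
  with right-hand side \<open>f\<close> there. A series that solves the system on one branch
  solves it on the continuation of that branch around \<open>t0\<close>, hence on every branch, so
  quantifying over all branches avoids fixing a cut without restricting the notion.
  All leading coefficients are nonzero: this is what it means for \<open>k\<close> to be the leading exponents.
\<close>

definition puiseux_solution ::
    "(complex ^ 'd \<Rightarrow> complex ^ 'd) \<Rightarrow> nat \<Rightarrow> ('d \<Rightarrow> int) \<Rightarrow> complex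
      \<Rightarrow> ('d \<Rightarrow> nat \<Rightarrow> complex) \<Rightarrow> bool" where
  "puiseux_solution f Q k t0 u \<longleftrightarrow>
     (\<forall>i. u i 0 \<noteq> 0) \<and>
     (\<exists>r>0. \<forall>S g. root_branch Q t0 S g \<and> S \<subseteq> ball t0 r - {t0} \<longrightarrow>
        (\<forall>t\<in>S. \<forall>i.
           summable (\<lambda>j. u i j * g t powi (k i + int j)) \<and>
           ((\<lambda>s. puiseux_vec k u (g s) $ i) has_field_derivative
              f (puiseux_vec k u (g t)) $ i) (at t)))"

text \<open>
  A family \<open>F\<close> of solutions (pairs of a singularity \<open>t0\<close> and coefficients \<open>u\<close>) with common
  leading exponents, at least one of them negative, and a full set of free parameters: \<open>t0\<close>
  together with the coefficients \<open>u i j\<close> at the \<open>d - 1\<close> positions \<open>(i, j) \<in> P\<close>. These can be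
  prescribed arbitrarily and independently of each other, except that a leading coefficient
  (\<open>j = 0\<close>) must be nonzero, and leave finitely many members of \<open>F\<close>. Finiteness is
  only required within \<open>F\<close>: solutions outside the family may have the same leading exponents.
\<close>

definition painleve_family :: "(complex ^ 'd \<Rightarrow> complex ^ 'd) \<Rightarrow> nat \<Rightarrow> bool" where
  "painleve_family f Q \<longleftrightarrow>
     (\<exists>(k :: 'd \<Rightarrow> int) (P :: ('d \<times> nat) set) (F :: (complex \<times> ('d \<Rightarrow> nat \<Rightarrow> complex)) set).
        (\<exists>i. k i < 0) \<and>
        finite P \<and> card P = CARD('d) - 1 \<and>
        (\<forall>(t0, u) \<in> F. puiseux_solution f Q k t0 u) \<and>
        (\<forall>t0. \<forall>p :: 'd \<times> nat \<Rightarrow> complex. (\<forall>i. (i, 0) \<in> P \<longrightarrow> p (i, 0) \<noteq> 0) \<longrightarrow>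
           (let M = {u. (t0, u) \<in> F \<and> (\<forall>(i, j) \<in> P. u i j = p (i, j))}
            in M \<noteq> {} \<and> finite M)))"

definition weak_painleve_test :: "(complex ^ 'd \<Rightarrow> complex ^ 'd) \<Rightarrow> bool" where
  "weak_painleve_test f \<longleftrightarrow> (\<exists>Q>0. painleve_family f Q)"

definition strong_painleve_test :: "(complex ^ 'd \<Rightarrow> complex ^ 'd) \<Rightarrow> bool" where
  "strong_painleve_test f \<longleftrightarrow> painleve_family f 1"

lemma strong_imp_weak_painleve_test: "strong_painleve_test f \<Longrightarrow> weak_painleve_test f"
  unfolding strong_painleve_test_def weak_painleve_test_def by (intro exI[of _ 1]) simp

definition soliton_system :: "nat \<Rightarrow> real \<Rightarrow> complex ^ 3 \<Rightarrow> complex ^ 3" where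
  "soliton_system n l v =
     (let x = v $ 1; y = v $ 2; z = v $ 3
      in vector [x\<^sup>2 - x * y + of_real l * z\<^sup>2 + of_nat n - 1,
                 x * y - of_nat n * x\<^sup>2 + of_real l * z\<^sup>2,
                 x * z])"

end

theory Submission
  imports Defs "HOL-Complex_Analysis.Laurent_Convergence"
begin

text \<open>
  The system allows only one kind of singularity in the sense of the test, and the solutions with that
  singularity have at most two free parameters instead of three.

  In the root variable \<open>w\<close> with \<open>w ^ Q = t - t0\<close> a candidate solution is a convergent Laurent series, so the
  differential equations become identities between Laurent coefficients
  (\<open>soliton_laurent_equations\<close>). Since \<open>x\<close> is the logarithmic derivative of \<open>z\<close>, comparing
  leading terms shows that \<open>x\<close> has a simple pole in \<open>t\<close> and that \<open>y\<close> and \<open>z\<close> are at most that singular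
  (\<open>X_pole\<close>, \<open>pole_orders_ge\<close>). Two balances remain.

  Either \<open>z\<close> is less singular than \<open>x\<close>. Then \<open>x\<close> and \<open>y\<close> are governed at leading order by a planar
  homogeneous system whose resonance is exactly the index at which \<open>l z ^ 2\<close> enters. The compatibility condition
  fails there, so this balance has no solutions with \<open>z \<noteq> 0\<close> (\<open>c0_nonzero\<close>).

  Or \<open>x\<close>, \<open>y\<close> and \<open>z\<close> all have simple poles, with leading coefficients \<open>-1\<close>, \<open>-n\<close> and a square root of
  \<open>n / l\<close>. With \<open>s = j / Q\<close> the resonance polynomial is \<open>(s + 1) (s ^ 2 - n s - 2 n)\<close>, whose second factor
  has one positive and one negative root (\<open>higher_coeffs\<close>, \<open>resonant_unique\<close>). So besides \<open>t0\<close> at most one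
  coefficient is free, and all others are polynomials in it (\<open>coeffs_polynomial_in_parameter\<close>).

  A full family would let two coefficients take arbitrary nonzero values independently. The pairs of
  values that occur lie on two polynomial curves, one for each sign of the square root, and these miss
  some point with nonzero coordinates (\<open>finite_polynomial_curves_miss_point\<close>).
\<close>

notation fls_nth (infixl "$$" 75)

section \<open>Laurent expansion of a Puiseux solution in the root variable\<close>

text \<open>
  Every small nonzero value \<open>w\<close> of the root is attained by some branch, namely
  \<open>w\<close> times the principal root of \<open>(t - t0) / w ^ Q\<close>, which is near \<open>1\<close>. Hence a statement about
  all branches becomes a statement about a full punctured disc in \<open>w\<close>.
\<close>
lemma root_branch_through:
  assumes "Q > 0" "w \<noteq> 0" "norm (w ^ Q) < r"
  obtains S g where "root_branch Q t0 S g" "S \<subseteq> ball t0 r - {t0}" "t0 + w ^ Q \<in> S"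
    "g (t0 + w ^ Q) = w" "(g has_field_derivative w / (of_nat Q * w ^ Q)) (at (t0 + w ^ Q))"
proof -
  define h where "h = (\<lambda>t. (t - t0) / w ^ Q)"
  define S where "S = h -` (- \<real>\<^sub>\<le>\<^sub>0) \<inter> ball t0 r"
  define g where "g = (\<lambda>t. w * exp (Ln (h t) / of_nat Q))"
  have h: "continuous_on A h" for A
    unfolding h_def using assms by (intro continuous_intros) auto
  have ne: "h t \<noteq> 0" if "t \<in> S" for t using that unfolding S_def by auto
  have "open S" unfolding S_def
    by (intro open_Int open_vimage h) (auto intro: closed_nonpos_Reals_complex)
  moreover have "continuous_on S g" unfolding g_def
    by (intro continuous_intros h) (auto simp: S_def \<open>Q > 0\<close>)
  moreover have "g t ^ Q = t - t0" if "t \<in> S" for t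
  proof -
    have "g t ^ Q = w ^ Q * exp (of_nat Q * (Ln (h t) / of_nat Q))"
      unfolding g_def power_mult_distrib exp_of_nat_mult ..
    also have "\<dots> = w ^ Q * h t" using ne[OF that] \<open>Q > 0\<close> by simp
    finally show ?thesis using assms by (simp add: h_def)
  qed
  ultimately have 1: "root_branch Q t0 S g" unfolding root_branch_def by blast
  have 2: "S \<subseteq> ball t0 r - {t0}"
    using ne unfolding S_def by (auto simp: h_def)
  have h1: "h (t0 + w ^ Q) = 1" using assms by (simp add: h_def)
  have 3: "t0 + w ^ Q \<in> S" using assms h1 by (auto simp: S_def dist_norm)
  have 4: "g (t0 + w ^ Q) = w" by (simp add: g_def h1)
  have "(h has_field_derivative 1 / w ^ Q) (at (t0 + w ^ Q))"
    unfolding h_def using assms by (auto intro!: derivative_eq_intros)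
  hence "(g has_field_derivative w / (of_nat Q * w ^ Q)) (at (t0 + w ^ Q))"
    unfolding g_def using h1 assms by (auto intro!: derivative_eq_intros)
  with 1 2 3 4 show thesis by (rule that)
qed

definition component_fls :: "int \<Rightarrow> (nat \<Rightarrow> complex) \<Rightarrow> complex fls" where
  "component_fls k a = fls_shift (- k) (fps_to_fls (Abs_fps a))"

lemma component_fls_nth:
  "component_fls k a $$ m = (if m < k then 0 else a (nat (m - k)))"
  by (simp add: component_fls_def)

lemma component_fls_subdegree: "a 0 \<noteq> 0 \<Longrightarrow> fls_subdegree (component_fls k a) = k"
  by (rule fls_subdegree_eqI) (auto simp: component_fls_nth)

lemma component_has_laurent_expansion:
  assumes sm: "summable (\<lambda>j. a j * w0 powi (k + int j))" and "w0 \<noteq> 0"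
  shows "(\<lambda>w. \<Sum>j. a j * w powi (k + int j)) has_laurent_expansion component_fls k a"
proof -
  have "summable (\<lambda>j. a j * w0 ^ j)"
    using summable_mult[OF sm, of "w0 powi (-k)"] \<open>w0 \<noteq> 0\<close>
    by (simp add: power_int_add power_int_minus field_simps)
  hence "conv_radius a \<ge> norm w0" by (rule conv_radius_geI)
  hence R: "fps_conv_radius (Abs_fps a) \<ge> norm w0" by (simp add: fps_conv_radius_def)
  have "eval_fls (component_fls k a) w = (\<Sum>j. a j * w powi (k + int j))"
    if w: "w \<noteq> 0" "norm w < norm w0" for w
  proof -
    have c: "ereal (norm w) < fps_conv_radius (Abs_fps a)"
      by (rule less_le_trans[OF _ R]) (use w in simp)
    have "eval_fls (component_fls k a) w = (\<Sum>j. a j * w ^ j) * w powi k"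
      using w c by (simp add: component_fls_def eval_fls_shift eval_fps_to_fls eval_fps_def)
    also have "\<dots> = (\<Sum>j. a j * w ^ j * w powi k)"
      using suminf_mult2[OF summable_fps[OF c], of "w powi k"] by simp
    also have "\<dots> = (\<Sum>j. a j * w powi (k + int j))"
      using w by (simp add: power_int_add mult_ac)
    finally show ?thesis .
  qed
  moreover have "eventually (\<lambda>w. w \<noteq> 0 \<and> norm w < norm w0) (at 0)"
    using eventually_at_in_open[of "ball 0 (norm w0)" 0] \<open>w0 \<noteq> 0\<close>
    by (auto elim!: eventually_mono)
  ultimately have "eventually (\<lambda>w. eval_fls (component_fls k a) w = (\<Sum>j. a j * w powi (k + int j))) (at 0)"
    by (auto elim!: eventually_mono)
  moreover have "fls_conv_radius (component_fls k a) > 0"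
    using less_le_trans[OF _ R, of 0] \<open>w0 \<noteq> 0\<close> by (simp add: component_fls_def)
  ultimately show ?thesis by (simp add: has_laurent_expansion_def)
qed

text \<open>
  In the variable \<open>w\<close> with \<open>t = t0 + w ^ Q\<close> a solution is a genuine Laurent series, and
  \<open>d/dt\<close> becomes \<open>w / (Q w ^ Q)\<close> times \<open>d/dw\<close>.
\<close>
lemma puiseux_solution_laurent:
  assumes sol: "puiseux_solution f Q k t0 u" and "Q > 0"
  shows "(\<lambda>w. puiseux_vec k u w $ i) has_laurent_expansion component_fls (k i) (u i)"
    and "eventually (\<lambda>w. w * deriv (\<lambda>w. puiseux_vec k u w $ i) w
            = of_nat Q * w ^ Q * f (puiseux_vec k u w) $ i) (at 0)"
proof -
  obtain r where "r > 0" and all_branches: "\<forall>S g. root_branch Q t0 S g \<and> S \<subseteq> ball t0 r - {t0} \<longrightarrow>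
      (\<forall>t\<in>S. \<forall>i. summable (\<lambda>j. u i j * g t powi (k i + int j)) \<and>
         ((\<lambda>s. puiseux_vec k u (g s) $ i) has_field_derivative f (puiseux_vec k u (g t)) $ i) (at t))"
    using sol unfolding puiseux_solution_def by (elim conjE exE) (rule that)
  have r: "summable (\<lambda>j. u i j * g t powi (k i + int j))"
      "((\<lambda>s. puiseux_vec k u (g s) $ i) has_field_derivative f (puiseux_vec k u (g t)) $ i) (at t)"
    if "root_branch Q t0 S g" "S \<subseteq> ball t0 r - {t0}" "t \<in> S" for S g t i
    using all_branches[rule_format, OF conjI, OF that] by blast+
  let ?\<phi> = "\<lambda>w. puiseux_vec k u w $ i" and ?F = "component_fls (k i) (u i)"
  have small: "eventually (\<lambda>w::complex. w \<noteq> 0 \<and> norm (w ^ Q) < r) (at 0)"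
  proof -
    have "((\<lambda>w::complex. norm (w ^ Q)) \<longlongrightarrow> norm ((0::complex) ^ Q)) (at 0)"
      by (intro tendsto_intros)
    hence "eventually (\<lambda>w::complex. norm (w ^ Q) < r) (at 0)"
      by (rule order_tendstoD) (use \<open>r > 0\<close> \<open>Q > 0\<close> in \<open>simp add: zero_power\<close>)
    thus ?thesis by (intro eventually_conj) (simp_all add: eventually_at_filter)
  qed
  then obtain w0 :: complex where w0: "w0 \<noteq> 0" "norm (w0 ^ Q) < r"
    using eventually_happens'[OF _ small] by auto
  obtain S g where "root_branch Q t0 S g" "S \<subseteq> ball t0 r - {t0}" "t0 + w0 ^ Q \<in> S" "g (t0 + w0 ^ Q) = w0"
    by (rule root_branch_through[OF \<open>Q > 0\<close> w0])
  with r(1)[of S g "t0 + w0 ^ Q" i] have "summable (\<lambda>j. u i j * w0 powi (k i + int j))" by simp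
  from component_has_laurent_expansion[OF this w0(1)]
  show L: "?\<phi> has_laurent_expansion ?F" by (simp add: puiseux_vec_def)
  have diff: "eventually (\<lambda>w. (?\<phi> has_field_derivative deriv ?\<phi> w) (at w)) (at 0)"
  proof -
    have "eventually (\<lambda>w. w \<in> eball 0 (fls_conv_radius ?F) - {0}) (at 0)"
      using L by (intro eventually_at_in_open) (auto simp: has_laurent_expansion_def zero_ereal_def)
    moreover obtain s where "open s" "0 \<in> s" and s: "\<And>w. w \<in> s - {0} \<Longrightarrow> eval_fls ?F w = ?\<phi> w"
      using L by (auto simp: has_laurent_expansion_def eventually_nhds eventually_at_filter)
    hence "eventually (\<lambda>w. w \<in> s - {0}) (at 0)"
      by (intro eventually_at_in_open) auto
    ultimately show ?thesis
    proof eventually_elim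
      case (elim w)
      have "eventually (\<lambda>w. w \<in> s - {0}) (nhds w)"
        using elim \<open>open s\<close> by (intro eventually_nhds_in_open) auto
      hence eq: "eventually (\<lambda>w. eval_fls ?F w = ?\<phi> w) (nhds w)"
        by eventually_elim (use s in auto)
      have "eval_fls ?F analytic_on {w}" using elim
        by (intro analytic_on_eval_fls) auto
      hence "?\<phi> analytic_on {w}" using analytic_at_cong[OF eq refl] by simp
      thus ?case by (rule analytic_derivI)
    qed
  qed
  show "eventually (\<lambda>w. w * deriv ?\<phi> w = of_nat Q * w ^ Q * f (puiseux_vec k u w) $ i) (at 0)"
    using small diff
  proof eventually_elim
    case (elim w)
    then obtain S g where g: "root_branch Q t0 S g" "S \<subseteq> ball t0 r - {t0}" "t0 + w ^ Q \<in> S"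
      "g (t0 + w ^ Q) = w" "(g has_field_derivative w / (of_nat Q * w ^ Q)) (at (t0 + w ^ Q))"
      using root_branch_through[OF \<open>Q > 0\<close>, of w r t0] by blast
    have "((\<lambda>s. ?\<phi> (g s)) has_field_derivative f (puiseux_vec k u w) $ i) (at (t0 + w ^ Q))"
      using r(2)[OF g(1-3), of i] g(4) by simp
    moreover have "((\<lambda>s. ?\<phi> (g s)) has_field_derivative deriv ?\<phi> w * (w / (of_nat Q * w ^ Q))) (at (t0 + w ^ Q))"
      by (rule DERIV_chain2) (use elim(2) g(4,5) in simp_all)
    ultimately have "f (puiseux_vec k u w) $ i = deriv ?\<phi> w * (w / (of_nat Q * w ^ Q))"
      by (rule DERIV_unique)
    thus ?case using elim(1) \<open>Q > 0\<close> by (simp add: field_simps)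
  qed
qed

text \<open>
  Laurent expansions are unique, so the differential equations may be compared coefficient by
  coefficient. The Euler operator \<open>w d/dw\<close> acts diagonally on coefficients, and the factor \<open>w ^ Q\<close> on the
  other side is the index shift by \<open>Q\<close>.
\<close>
lemma soliton_laurent_equations:
  fixes l :: real
  assumes sol: "puiseux_solution (soliton_system n l) Q k t0 u" and "Q > 0"
  defines "X \<equiv> component_fls (k 1) (u 1)" and "Y \<equiv> component_fls (k 2) (u 2)"
    and "Z \<equiv> component_fls (k 3) (u 3)"
  shows "of_int m * X $$ m = of_nat Q * ((X * X) $$ (m - int Q) - (X * Y) $$ (m - int Q)
           + of_real l * (Z * Z) $$ (m - int Q) + (if m = int Q then of_nat n - 1 else 0))"
    and "of_int m * Y $$ m = of_nat Q * ((X * Y) $$ (m - int Q) - of_nat n * (X * X) $$ (m - int Q)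
           + of_real l * (Z * Z) $$ (m - int Q))"
    and "of_int m * Z $$ m = of_nat Q * (X * Z) $$ (m - int Q)"
proof -
  let ?x = "\<lambda>i w. puiseux_vec k u w $ i"
  note L = puiseux_solution_laurent(1)[OF assms(1,2)]
  have euler: "fls_X * fls_deriv (component_fls (k i) (u i)) = fls_const (of_nat Q) * fls_X ^ Q * G"
    if G: "(\<lambda>w. soliton_system n l (puiseux_vec k u w) $ i) has_laurent_expansion G" for i G
  proof (rule has_laurent_expansion_unique)
    show "(\<lambda>w. w * deriv (?x i) w) has_laurent_expansion fls_X * fls_deriv (component_fls (k i) (u i))"
      by (intro laurent_expansion_intros L)
    have "(\<lambda>w. of_nat Q * w ^ Q * soliton_system n l (puiseux_vec k u w) $ i)
            has_laurent_expansion fls_const (of_nat Q) * fls_X ^ Q * G"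
      by (intro laurent_expansion_intros G)
    thus "(\<lambda>w. w * deriv (?x i) w) has_laurent_expansion fls_const (of_nat Q) * fls_X ^ Q * G"
      using puiseux_solution_laurent(2)[OF assms(1,2), of i]
      by (subst has_laurent_expansion_cong) auto
  qed
  have coeff: "of_int m * component_fls (k i) (u i) $$ m = of_nat Q * G $$ (m - int Q)"
    if "(\<lambda>w. soliton_system n l (puiseux_vec k u w) $ i) has_laurent_expansion G" for i G
    using arg_cong[OF euler[OF that], of "\<lambda>F. F $$ m"]
    unfolding mult.assoc fls_X_times_conv_shift(1) fls_X_power_times_conv_shift(1) by simp
  note LX = L[of 1, folded X_def] and LY = L[of 2, folded Y_def] and LZ = L[of 3, folded Z_def]
  have "(\<lambda>w. soliton_system n l (puiseux_vec k u w) $ 1) has_laurent_expansion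
      X * X - X * Y + fls_const (of_real l) * (Z * Z) + fls_const (of_nat n - 1)"
    unfolding soliton_system_def Let_def vector_3 power2_eq_square add_diff_eq[symmetric]
    by (intro laurent_expansion_intros LX LY LZ)
  from coeff[OF this] show "of_int m * X $$ m = of_nat Q * ((X * X) $$ (m - int Q) - (X * Y) $$ (m - int Q)
           + of_real l * (Z * Z) $$ (m - int Q) + (if m = int Q then of_nat n - 1 else 0))"
    by (simp add: X_def)
  have "(\<lambda>w. soliton_system n l (puiseux_vec k u w) $ 2) has_laurent_expansion
      X * Y - fls_const (of_nat n) * (X * X) + fls_const (of_real l) * (Z * Z)"
    unfolding soliton_system_def Let_def vector_3 power2_eq_square
    by (intro laurent_expansion_intros LX LY LZ)
  from coeff[OF this] show "of_int m * Y $$ m = of_nat Q * ((X * Y) $$ (m - int Q) - of_nat n * (X * X) $$ (m - int Q)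
           + of_real l * (Z * Z) $$ (m - int Q))"
    by (simp add: Y_def)
  have "(\<lambda>w. soliton_system n l (puiseux_vec k u w) $ 3) has_laurent_expansion X * Z"
    unfolding soliton_system_def Let_def vector_3
    by (intro laurent_expansion_intros LX LY LZ)
  from coeff[OF this] show "of_int m * Z $$ m = of_nat Q * (X * Z) $$ (m - int Q)"
    by (simp add: Z_def)
qed

section \<open>Leading orders\<close>

locale soliton_laurent =
  fixes X Y Z :: "complex fls" and n Q :: nat and l :: complex
  assumes Q_pos: "Q > 0" and n_pos: "n \<ge> 1" and l_nz: "l \<noteq> 0"
    and nz: "X \<noteq> 0" "Y \<noteq> 0" "Z \<noteq> 0"
    and X_eq: "\<And>m. of_int m * X $$ m = of_nat Q * ((X * X) $$ (m - int Q) - (X * Y) $$ (m - int Q)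
           + l * (Z * Z) $$ (m - int Q) + (if m = int Q then of_nat n - 1 else 0))"
    and Y_eq: "\<And>m. of_int m * Y $$ m = of_nat Q * ((X * Y) $$ (m - int Q) - of_nat n * (X * X) $$ (m - int Q)
           + l * (Z * Z) $$ (m - int Q))"
    and Z_eq: "\<And>m. of_int m * Z $$ m = of_nat Q * (X * Z) $$ (m - int Q)"
begin

abbreviation "p \<equiv> fls_subdegree X"
abbreviation "q \<equiv> fls_subdegree Y"
abbreviation "r \<equiv> fls_subdegree Z"

lemma base_nz: "X $$ p \<noteq> 0" "Y $$ q \<noteq> 0" "Z $$ r \<noteq> 0"
  using nz by simp_all

text \<open>
  The third equation says that \<open>x\<close> is the logarithmic derivative of \<open>z\<close>. So the pole of \<open>x\<close> is at most
  simple in \<open>t\<close>, with residue the order of \<open>z\<close> in \<open>t\<close>;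
  and if \<open>x\<close> has no such pole, \<open>z\<close> has order \<open>0\<close>.
\<close>
lemma X_order_ge: "p \<ge> - int Q"
proof (rule ccontr)
  assume "\<not> p \<ge> - int Q"
  hence "of_nat Q * (X * Z) $$ (p + r) = 0" using Z_eq[of "p + r + int Q"] by simp
  thus False using base_nz Q_pos by simp
qed

lemma Z_order: "p > - int Q \<Longrightarrow> r = 0"
  "p = - int Q \<Longrightarrow> X $$ p = of_int r / of_nat Q" "p = - int Q \<Longrightarrow> r \<noteq> 0"
proof -
  assume "p > - int Q"
  hence "(X * Z) $$ (r - int Q) = 0" by (intro fls_times_nth_eq0) simp
  thus "r = 0" using Z_eq[of r] base_nz by simp
next
  assume p: "p = - int Q"
  hence "of_int r * Z $$ r = of_nat Q * (X $$ p * Z $$ r)" using Z_eq[of r] fls_times_base[of X Z] by (simp add: algebra_simps)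
  thus 1: "X $$ p = of_int r / of_nat Q" using base_nz Q_pos by (simp add: field_simps)
  thus "r \<noteq> 0" using base_nz by auto
qed

text \<open>
  If \<open>x\<close> had no simple pole in \<open>t\<close>, then \<open>z\<close> would have order \<open>0\<close>. Differentiation lowers an order by
  \<open>Q\<close>, and under this bound no product is singular enough to balance that in both of the first two equations.
\<close>
lemma X_pole: assumes "p < 0 \<or> q < 0 \<or> r < 0" shows "p = - int Q"
proof (rule ccontr)
  assume "p \<noteq> - int Q"
  hence pQ: "p > - int Q" using X_order_ge by simp
  hence r: "r = 0" by (rule Z_order)
  have "q > - int Q \<and> p < 0"
  proof (cases "q < 0")
    case True
    have "(X * Y) $$ (q - int Q) = 0" "(Z * Z) $$ (q - int Q) = 0"
      using pQ r True by (intro fls_times_nth_eq0; simp)+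
    hence "(X * X) $$ (q - int Q) \<noteq> 0" using Y_eq[of q] base_nz True by auto
    hence "q - int Q \<ge> p + p" using fls_times_nth_eq0[of "q - int Q" X X] by fastforce
    thus ?thesis using True pQ by linarith
  qed (use assms r Q_pos in auto)
  hence q: "q > - int Q" and p: "p < 0" by auto
  have "(X * X) $$ (p - int Q) = 0" "(X * Y) $$ (p - int Q) = 0" "(Z * Z) $$ (p - int Q) = 0"
    using pQ r p q by (intro fls_times_nth_eq0; simp)+
  hence "of_int p * X $$ p = 0" using X_eq[of p] p by simp
  thus False using p base_nz by simp
qed

text \<open>
  If \<open>z\<close> were more singular than \<open>x\<close>, the term \<open>l z ^ 2\<close> in the first equation could only be cancelled by
  \<open>x y\<close>. This forces \<open>q = 2 r + Q\<close>, while the leading terms of the second equation then give \<open>q = 2 r\<close>.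
\<close>
lemma pole_orders_ge: assumes p: "p = - int Q" shows "q \<ge> - int Q" "r \<ge> - int Q"
proof -
  show r: "r \<ge> - int Q"
  proof (rule ccontr)
    assume r: "\<not> r \<ge> - int Q"
    have "X $$ (2 * r + int Q) = 0" "(X * X) $$ (2 * r) = 0"
      using r p by (auto intro: fls_times_nth_eq0)
    hence 1: "(X * Y) $$ (2 * r) = l * (Z $$ r * Z $$ r)"
      using X_eq[of "2 * r + int Q"] r Q_pos fls_times_base[of Z Z] by (simp flip: mult_2)
    hence 2: "q \<le> 2 * r + int Q" using fls_times_nth_eq0[of "2 * r" X Y] p base_nz l_nz by fastforce
    have 3: "q = 2 * r + int Q"
    proof (rule ccontr)
      assume "q \<noteq> 2 * r + int Q"
      hence q: "q < 2 * r + int Q" using 2 by simp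
      have "X $$ q = 0" "(X * X) $$ (q - int Q) = 0" "(Z * Z) $$ (q - int Q) = 0"
        using q r p by (auto intro: fls_times_nth_eq0)
      hence "(X * Y) $$ (q - int Q) = 0" using X_eq[of q] Q_pos q r by simp
      thus False using fls_times_base[of X Y] base_nz p by (simp add: algebra_simps)
    qed
    have "(X * X) $$ (2 * r) = 0" using r p by (auto intro: fls_times_nth_eq0)
    moreover have xy: "(X * Y) $$ (2 * r) = X $$ p * Y $$ q"
      using fls_times_base[of X Y] 3 p by (simp add: algebra_simps)
    ultimately have "of_int q * Y $$ q = of_nat Q * (X $$ p * Y $$ q + X $$ p * Y $$ q)"
      using Y_eq[of q] 1 3 fls_times_base[of Z Z] by (simp flip: mult_2)
    hence "of_int q = (of_int (2 * r) :: complex)"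
      using base_nz Z_order(2)[OF p] Q_pos by (simp add: field_simps)
    hence "q = 2 * r" unfolding of_int_eq_iff .
    thus False using 3 Q_pos by simp
  qed
  show "q \<ge> - int Q"
  proof (rule ccontr)
    assume q: "\<not> q \<ge> - int Q"
    have "X $$ q = 0" "(X * X) $$ (q - int Q) = 0" "(Z * Z) $$ (q - int Q) = 0"
      using q r p by (auto intro: fls_times_nth_eq0)
    hence "(X * Y) $$ (q - int Q) = 0" using X_eq[of q] Q_pos q by simp
    thus False using fls_times_base[of X Y] base_nz p by (simp add: algebra_simps)
  qed
qed

end

section \<open>The recursion for the coefficients\<close>

text \<open>
  The part of the Cauchy product that involves neither a leading coefficient nor the coefficient
  of index \<open>j\<close>, which is the unknown at step \<open>j\<close> of the recursion.
\<close>
definition inner_conv :: "(nat \<Rightarrow> 'a::comm_ring_1) \<Rightarrow> (nat \<Rightarrow> 'a) \<Rightarrow> nat \<Rightarrow> 'a" where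
  "inner_conv f g j = (\<Sum>i\<in>{0<..<j}. f i * g (j - i))"

lemma conv_split_ends:
  assumes "j > 0"
  shows "(\<Sum>i\<le>j. f i * g (j - i)) = f 0 * g j + f j * g 0 + inner_conv f g j"
proof -
  have "{..j} = insert 0 (insert j {0<..<j})" using assms by auto
  thus ?thesis using assms by (simp add: inner_conv_def)
qed

lemma fls_times_nth_pole:
  fixes X Y :: "'a::comm_ring_1 fls"
  assumes "fls_subdegree X \<ge> - int Q" "fls_subdegree Y \<ge> - int Q"
  shows "(X * Y) $$ (int j - int Q - int Q) = (\<Sum>i\<le>j. X $$ (int i - int Q) * Y $$ (int (j - i) - int Q))"
proof -
  have sh: "F = fls_shift (int Q) (fps_to_fls (Abs_fps (\<lambda>i. F $$ (int i - int Q))))"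
    if "fls_subdegree F \<ge> - int Q" for F :: "'a fls"
    using that by (intro fls_eqI) auto
  have "X * Y = fls_shift (int Q + int Q) (fps_to_fls
      (Abs_fps (\<lambda>i. X $$ (int i - int Q)) * Abs_fps (\<lambda>i. Y $$ (int i - int Q))))"
    using sh[OF assms(1)] sh[OF assms(2)] fls_times_both_shifted_simp fls_times_fps_to_fls by metis
  thus ?thesis by (simp add: fps_mult_nth atLeast0AtMost)
qed

text \<open>
  The equations for \<open>x = w powi (-Q) * a(w)\<close> and likewise \<open>y\<close>, \<open>z\<close> with power series \<open>b\<close>, \<open>c\<close>. The leading
  coefficients may vanish, so this covers every case that the order analysis leaves.
\<close>
locale soliton_recursion =
  fixes a b c :: "nat \<Rightarrow> complex" and n Q :: nat and l :: complex
  assumes Q_pos: "Q > 0" and n_pos: "n \<ge> 1" and l_nz: "l \<noteq> 0"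
    and a_rec: "\<And>j. (of_nat j / of_nat Q - 1) * a j = (\<Sum>i\<le>j. a i * a (j - i)) - (\<Sum>i\<le>j. a i * b (j - i))
           + l * (\<Sum>i\<le>j. c i * c (j - i)) + (if j = 2 * Q then of_nat n - 1 else 0)"
    and b_rec: "\<And>j. (of_nat j / of_nat Q - 1) * b j = (\<Sum>i\<le>j. a i * b (j - i))
           - of_nat n * (\<Sum>i\<le>j. a i * a (j - i)) + l * (\<Sum>i\<le>j. c i * c (j - i))"
    and c_rec: "\<And>j. (of_nat j / of_nat Q - 1) * c j = (\<Sum>i\<le>j. a i * c (j - i))"
begin

lemma a0_of_c_order:
  assumes "\<And>i. i < R \<Longrightarrow> c i = 0" "c R \<noteq> 0"
  shows "a 0 = of_nat R / of_nat Q - 1"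
proof -
  have "(\<Sum>i\<le>R. a i * c (R - i)) = (\<Sum>i\<in>{0}. a i * c (R - i))"
    by (rule sum.mono_neutral_right) (use assms in auto)
  thus ?thesis using c_rec[of R] assms(2) by simp
qed

lemma c0_zero_relations:
  assumes "c 0 = 0" "a 0 \<noteq> 0"
  shows "b 0 = a 0 + 1" "of_nat n * (a 0)\<^sup>2 = (a 0 + 1)\<^sup>2"
proof -
  have "a 0 * b 0 = a 0 * (a 0 + 1)" using a_rec[of 0] assms(1) Q_pos by (simp add: algebra_simps)
  thus 1: "b 0 = a 0 + 1" using assms(2) by simp
  show "of_nat n * (a 0)\<^sup>2 = (a 0 + 1)\<^sup>2"
    using b_rec[of 0] assms(1) 1 by (simp add: algebra_simps power2_eq_square)
qed

text \<open>
  Put \<open>d = R - Q\<close>, the order of \<open>z\<close> in \<open>w\<close>. The leading relation becomes \<open>n d ^ 2 = R ^ 2\<close>, hence \<open>d\<close> divides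
  \<open>R\<close> and therefore \<open>Q\<close>. So rationality of the exponent confines the order of \<open>z\<close>.
\<close>
lemma c_order_bound:
  assumes "a 0 = of_nat R / of_nat Q - 1" "of_nat n * (a 0)\<^sup>2 = (a 0 + 1)\<^sup>2"
  shows "R \<le> 2 * Q"
proof -
  define d where "d = int R - int Q"
  have "of_nat n * (of_nat Q * a 0)\<^sup>2 = (of_nat Q * a 0 + of_nat Q)\<^sup>2"
  proof -
    have "of_nat n * (of_nat Q * a 0)\<^sup>2 = (of_nat Q)\<^sup>2 * (of_nat n * (a 0)\<^sup>2)"
      by (simp add: power_mult_distrib)
    also have "\<dots> = (of_nat Q * a 0 + of_nat Q)\<^sup>2" unfolding assms(2)
      by (simp add: power2_eq_square algebra_simps)
    finally show ?thesis .
  qed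
  moreover have "of_nat Q * a 0 = of_int d" using assms(1) Q_pos by (simp add: d_def field_simps)
  ultimately have "of_int (int n * d\<^sup>2) = (of_int ((int R)\<^sup>2) :: complex)"
    by (simp add: d_def)
  hence e: "int n * d\<^sup>2 = (int R)\<^sup>2" unfolding of_int_eq_iff .
  hence "d\<^sup>2 dvd (int R)\<^sup>2" by (metis dvd_triv_right)
  hence "d dvd int R" by simp
  hence "d dvd int Q" using dvd_diff[of d "int R" d] by (simp add: d_def)
  hence "d \<le> int Q" using Q_pos by (intro zdvd_imp_le) auto
  thus "R \<le> 2 * Q" by (simp add: d_def)
qed

text \<open>
  Suppose \<open>z\<close> is less singular than \<open>x\<close>, and let \<open>R > 0\<close> be the first index with \<open>c R \<noteq> 0\<close>. The
  linearised system for \<open>(a j, b j)\<close> is then singular only at \<open>j / Q = 2 (a 0 + 1)\<close>, that is, at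
  \<open>j = 2 R\<close>. This is exactly the first index to which \<open>l z ^ 2\<close> contributes, and its contribution
  violates the compatibility condition there unless \<open>c R = 0\<close>. (Otherwise the
  expansion would have to contain logarithms.)

  One must still see that no nonlinear term interferes. Below \<open>2 R\<close> only the constant \<open>n - 1\<close> can act,
  at \<open>j = 2 Q\<close>; its square could act at \<open>j = 4 Q\<close> at the earliest. By the bound on \<open>R\<close>
  this is within range only if \<open>R = 2 Q\<close>, that is \<open>a 0 = 1\<close>. In that case \<open>a (2 Q) = 0\<close>, and every
  quadratic term contains a factor \<open>a i\<close>.
\<close>
lemma c0_nonzero:
  assumes "a 0 \<noteq> 0" "\<exists>j. c j \<noteq> 0"
  shows "c 0 \<noteq> 0"
proof
  assume c0: "c 0 = 0"
  define R where "R = (LEAST j. c j \<noteq> 0)"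
  have cR: "c R \<noteq> 0" unfolding R_def using assms(2) by (rule LeastI_ex)
  have c_less: "c i = 0" if "i < R" for i using not_less_Least[of i "\<lambda>j. c j \<noteq> 0"] that by (auto simp: R_def)
  have "R > 0" using c0 cR by (cases R) auto
  define \<alpha> where "\<alpha> = a 0"
  note \<alpha>R = a0_of_c_order[OF c_less cR, folded \<alpha>_def]
  note b0 = c0_zero_relations[OF c0 assms(1), folded \<alpha>_def]
  have \<alpha>: "\<alpha> \<noteq> 0" using assms(1) by (simp add: \<alpha>_def)
  have RQ: "R \<noteq> Q" using \<alpha> \<alpha>R Q_pos by auto
  note bound = c_order_bound[folded \<alpha>_def, OF \<alpha>R b0(2)]
  have cc: "(\<Sum>i\<le>j. c i * c (j - i)) = 0" if "j < 2 * R" for j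
  proof (intro sum.neutral ballI)
    fix i assume "i \<in> {..j}"
    with that have "i < R \<or> j - i < R" by auto
    thus "c i * c (j - i) = 0" using c_less by auto
  qed
  have cc2: "(\<Sum>i\<le>2 * R. c i * c (2 * R - i)) = c R * c R"
  proof -
    have "(\<Sum>i\<le>2 * R. c i * c (2 * R - i)) = (\<Sum>i\<in>{R}. c i * c (2 * R - i))"
    proof (rule sum.mono_neutral_right)
      show "\<forall>i\<in>{..2 * R} - {R}. c i * c (2 * R - i) = 0"
      proof
        fix i assume "i \<in> {..2 * R} - {R}"
        hence "i < R \<or> 2 * R - i < R" by auto
        thus "c i * c (2 * R - i) = 0" using c_less by auto
      qed
    qed auto
    thus ?thesis by simp
  qed
  let ?P = "\<lambda>j. (j \<noteq> 2 * Q \<longrightarrow> a j = 0 \<and> b j = 0) \<and> (j = 2 * Q \<and> R = 2 * Q \<longrightarrow> a j = 0)"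
  \<comment> \<open>The linear system for step \<open>j\<close>; the second equation is multiplied by \<open>\<alpha>\<close> to use \<open>n \<alpha> ^ 2 = (\<alpha> + 1) ^ 2\<close>.\<close>
  have lin: "(of_nat j / of_nat Q - \<alpha>) * a j + \<alpha> * b j
        = l * (\<Sum>i\<le>j. c i * c (j - i)) + (if j = 2 * Q then of_nat n - 1 else 0)"
      "\<alpha> * (of_nat j / of_nat Q - 1 - \<alpha>) * b j
        = - (\<alpha> + 1) * (\<alpha> + 2) * a j + \<alpha> * l * (\<Sum>i\<le>j. c i * c (j - i))"
    if j: "j > 0" "j \<le> 2 * R" and P: "\<And>i. 0 < i \<Longrightarrow> i < j \<Longrightarrow> ?P i" for j
  proof -
    have *: "a i * a (j - i) = 0 \<and> a i * b (j - i) = 0" if i: "i \<in> {0<..<j}" for i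
    proof (cases "i = 2 * Q \<and> j - i = 2 * Q")
      case True
      hence "R = 2 * Q" using j bound by linarith
      thus ?thesis using P[of i] i True by simp
    next
      case False
      thus ?thesis using P[of i] P[of "j - i"] i by auto
    qed
    hence in0: "inner_conv a a j = 0" "inner_conv a b j = 0"
      unfolding inner_conv_def by (auto intro!: sum.neutral)
    show "(of_nat j / of_nat Q - \<alpha>) * a j + \<alpha> * b j
        = l * (\<Sum>i\<le>j. c i * c (j - i)) + (if j = 2 * Q then of_nat n - 1 else 0)"
      using a_rec[of j] unfolding conv_split_ends[OF j(1), of a] in0 b0(1) \<alpha>_def[symmetric]
      by (simp add: algebra_simps)
    have "(of_nat j / of_nat Q - 1) * b j = \<alpha> * b j + a j * (\<alpha> + 1) - of_nat n * (\<alpha> * a j + a j * \<alpha>)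
        + l * (\<Sum>i\<le>j. c i * c (j - i))"
      using b_rec[of j] unfolding conv_split_ends[OF j(1), of a] in0 b0(1) \<alpha>_def[symmetric] by simp
    hence "\<alpha> * (of_nat j / of_nat Q - 1 - \<alpha>) * b j
      = \<alpha> * (\<alpha> + 1) * a j - 2 * (of_nat n * \<alpha>\<^sup>2) * a j + \<alpha> * l * (\<Sum>i\<le>j. c i * c (j - i))"
      by algebra
    thus "\<alpha> * (of_nat j / of_nat Q - 1 - \<alpha>) * b j
        = - (\<alpha> + 1) * (\<alpha> + 2) * a j + \<alpha> * l * (\<Sum>i\<le>j. c i * c (j - i))"
      unfolding b0(2) by (simp add: algebra_simps power2_eq_square)
  qed
  have \<alpha>R': "of_nat (2 * R) / of_nat Q = 2 * (\<alpha> + 1)" by (simp add: \<alpha>R)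
  have P: "?P j" if "0 < j" "j < 2 * R" for j
    using that
  proof (induction j rule: less_induct)
    case (less j)
    let ?s = "of_nat j / of_nat Q :: complex"
    have "j \<le> 2 * R" using less.prems by simp
    note L = lin[OF less.prems(1) this less.IH, unfolded cc[OF less.prems(2)]]
    have 1: "(?s - \<alpha>) * a j + \<alpha> * b j = (if j = 2 * Q then of_nat n - 1 else 0)"
      using L(1) less.prems by simp
    have 2: "\<alpha> * (?s - 1 - \<alpha>) * b j = - (\<alpha> + 1) * (\<alpha> + 2) * a j"
      using L(2) less.prems by simp
    show ?case
    proof (intro conjI impI)
      assume j: "j \<noteq> 2 * Q"
      hence "\<alpha> * b j = - (?s - \<alpha>) * a j" using 1 by (simp add: algebra_simps add_eq_0_iff)
      moreover have "(?s - 1 - \<alpha>) * (\<alpha> * b j) = - (\<alpha> + 1) * (\<alpha> + 2) * a j" using 2 by (simp add: mult_ac)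
      ultimately have "(?s - 1 - \<alpha>) * (- (?s - \<alpha>) * a j) = - (\<alpha> + 1) * (\<alpha> + 2) * a j" by simp
      hence "(?s + 1) * (?s - 2 * (\<alpha> + 1)) * a j = 0" by algebra
      \<comment> \<open>The determinant has the roots \<open>-1\<close> (a shift of the singularity) and \<open>2 R / Q\<close>.\<close>
      moreover have "?s - 2 * (\<alpha> + 1) \<noteq> 0"
        unfolding \<alpha>R'[symmetric] using less.prems Q_pos by (simp flip: of_nat_mult)
      moreover have "?s + 1 \<noteq> 0" using Q_pos of_nat_neq_0[of "j + Q - 1", where 'a = complex]
        by (simp add: field_simps flip: of_nat_add)
      ultimately show "a j = 0" by simp
      thus "b j = 0" using 1 j \<alpha> by simp
    next
      assume j: "j = 2 * Q \<and> R = 2 * Q"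
      thus "a j = 0" using 2 \<alpha>R Q_pos by simp
    qed
  qed
  have "(2 * (\<alpha> + 1) - \<alpha>) * a (2 * R) + \<alpha> * b (2 * R) = l * (c R * c R)"
    using lin(1)[of "2 * R"] P \<open>R > 0\<close> RQ unfolding cc2 \<alpha>R' by simp
  moreover have "\<alpha> * (2 * (\<alpha> + 1) - 1 - \<alpha>) * b (2 * R) = - (\<alpha> + 1) * (\<alpha> + 2) * a (2 * R) + \<alpha> * l * (c R * c R)"
    using lin(2)[of "2 * R"] P \<open>R > 0\<close> RQ unfolding cc2 \<alpha>R' by simp
  ultimately have "l * (c R * c R) = 0" by algebra
  thus False using cR l_nz by simp
qed

lemma leading_coeffs:
  assumes "c 0 \<noteq> 0"
  shows "a 0 = -1" "b 0 = - of_nat n" "l * (c 0)\<^sup>2 = of_nat n"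
proof -
  show 1: "a 0 = -1" using a0_of_c_order[of 0] assms by simp
  have "b 0 + l * (c 0)\<^sup>2 = 0" using a_rec[of 0] 1 Q_pos by (simp add: power2_eq_square)
  moreover show 2: "l * (c 0)\<^sup>2 = of_nat n" using b_rec[of 0] 1 by (simp add: power2_eq_square algebra_simps)
  ultimately show "b 0 = - of_nat n" by (simp add: eq_neg_iff_add_eq_0)
qed

text \<open>
  Solving the third equation for \<open>c j\<close> and the second for \<open>b j\<close> leaves one equation for \<open>a j\<close>. Its
  coefficient is the resonance polynomial. The root \<open>-1\<close> belongs to the free position of the singularity;
  the other two have the negative product \<open>-2 n\<close>, so at most one index \<open>j\<close> is resonant.
\<close>
lemma higher_coeffs:
  assumes "c 0 \<noteq> 0" and j: "j > 0"
  defines "s \<equiv> of_nat j / of_nat Q"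
  defines "R1 \<equiv> inner_conv a a j - inner_conv a b j + l * inner_conv c c j + (if j = 2 * Q then of_nat n - 1 else 0)"
    and "R2 \<equiv> inner_conv a b j - of_nat n * inner_conv a a j + l * inner_conv c c j"
    and "R3 \<equiv> inner_conv a c j"
  shows "s * c j = c 0 * a j + R3"
    and "s * b j = of_nat n * a j + 2 * l * c 0 * c j + R2"
    and "(s + 1) * (s\<^sup>2 - of_nat n * s - 2 * of_nat n) * a j = s\<^sup>2 * R1 + s * R2 + 2 * l * c 0 * (1 + s) * R3"
proof -
  note lead = leading_coeffs[OF assms(1)]
  have cc: "(s - 1) * c j = - c j + a j * c 0 + R3"
    using c_rec[of j] unfolding conv_split_ends[OF j] lead(1,2) R3_def s_def by simp
  have bb: "(s - 1) * b j = (- b j - of_nat n * a j) - of_nat n * (- 2 * a j) + 2 * l * c 0 * c j + R2"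
    using b_rec[of j] unfolding conv_split_ends[OF j] lead(1,2) R2_def s_def by (simp add: algebra_simps)
  have aa: "(s - 1) * a j = - 2 * a j - (- b j - of_nat n * a j) + 2 * l * c 0 * c j + R1"
    using a_rec[of j] unfolding conv_split_ends[OF j] lead(1,2) R1_def s_def by (simp add: algebra_simps)
  show C: "s * c j = c 0 * a j + R3" using cc by algebra
  show B: "s * b j = of_nat n * a j + 2 * l * c 0 * c j + R2" using bb by algebra
  show "(s + 1) * (s\<^sup>2 - of_nat n * s - 2 * of_nat n) * a j = s\<^sup>2 * R1 + s * R2 + 2 * l * c 0 * (1 + s) * R3"
    using aa B C lead(3) by algebra
qed

end

context soliton_laurent
begin

lemma soliton_recursion_of_laurent:
  assumes "p \<ge> - int Q" "q \<ge> - int Q" "r \<ge> - int Q"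
  shows "soliton_recursion (\<lambda>j. X $$ (int j - int Q)) (\<lambda>j. Y $$ (int j - int Q)) (\<lambda>j. Z $$ (int j - int Q)) n Q l"
proof
  fix j
  have e: "of_int (int j - int Q) = (of_nat j - of_nat Q :: complex)" by simp
  have i: "int j - int Q = int Q \<longleftrightarrow> j = 2 * Q" by auto
  have s: "(of_nat j / of_nat Q - 1) * v = w" if "(of_nat j - of_nat Q) * v = of_nat Q * w" for v w :: complex
    using that Q_pos by (simp add: field_simps)
  note T = fls_times_nth_pole[OF assms(1) assms(1)] fls_times_nth_pole[OF assms(1) assms(2)]
    fls_times_nth_pole[OF assms(1) assms(3)] fls_times_nth_pole[OF assms(3) assms(3)]
  show "(of_nat j / of_nat Q - 1) * X $$ (int j - int Q) =
      (\<Sum>i\<le>j. X $$ (int i - int Q) * X $$ (int (j - i) - int Q)) -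
      (\<Sum>i\<le>j. X $$ (int i - int Q) * Y $$ (int (j - i) - int Q)) +
      l * (\<Sum>i\<le>j. Z $$ (int i - int Q) * Z $$ (int (j - i) - int Q)) + (if j = 2 * Q then of_nat n - 1 else 0)"
    by (rule s) (use X_eq[of "int j - int Q"] in \<open>simp only: T e i\<close>)
  show "(of_nat j / of_nat Q - 1) * Y $$ (int j - int Q) =
      (\<Sum>i\<le>j. X $$ (int i - int Q) * Y $$ (int (j - i) - int Q)) -
      of_nat n * (\<Sum>i\<le>j. X $$ (int i - int Q) * X $$ (int (j - i) - int Q)) +
      l * (\<Sum>i\<le>j. Z $$ (int i - int Q) * Z $$ (int (j - i) - int Q))"
    by (rule s) (use Y_eq[of "int j - int Q"] in \<open>simp only: T e i\<close>)
  show "(of_nat j / of_nat Q - 1) * Z $$ (int j - int Q) =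
      (\<Sum>i\<le>j. X $$ (int i - int Q) * Z $$ (int (j - i) - int Q))"
    by (rule s) (use Z_eq[of "int j - int Q"] in \<open>simp only: T e i\<close>)
qed (use Q_pos n_pos l_nz in auto)

text \<open>
  Only the balance in which \<open>x\<close>, \<open>y\<close> and \<open>z\<close> all have a simple pole in \<open>t\<close> survives. In
  particular all leading exponents are integers in powers of \<open>t - t0\<close>, whatever \<open>Q\<close> is.
\<close>
lemma all_orders_simple_pole:
  assumes "p < 0 \<or> q < 0 \<or> r < 0"
  shows "p = - int Q" "q = - int Q" "r = - int Q"
proof -
  show p: "p = - int Q" by (rule X_pole[OF assms])
  note ge = pole_orders_ge[OF p]
  have "p \<ge> - int Q" using p by simp
  then interpret soliton_recursion "\<lambda>j. X $$ (int j - int Q)" "\<lambda>j. Y $$ (int j - int Q)" "\<lambda>j. Z $$ (int j - int Q)" n Q l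
    using ge by (rule soliton_recursion_of_laurent)
  have "Z $$ (int (nat (r + int Q)) - int Q) \<noteq> 0" using base_nz ge(2) by simp
  hence "\<exists>j. Z $$ (int j - int Q) \<noteq> 0" ..
  moreover have "X $$ (int 0 - int Q) \<noteq> 0" using base_nz p by simp
  ultimately have c0: "Z $$ (int 0 - int Q) \<noteq> 0" using c0_nonzero by simp
  thus "r = - int Q" using ge(2) by (auto intro!: antisym fls_subdegree_leI)
  have "Y $$ (int 0 - int Q) \<noteq> 0" using leading_coeffs(2)[OF c0] n_pos by simp
  thus "q = - int Q" using ge(1) by (auto intro!: antisym fls_subdegree_leI)
qed

end

lemma soliton_recursion_of_puiseux_solution:
  fixes l :: real
  assumes sol: "puiseux_solution (soliton_system n l) Q k t0 u"
    and "Q > 0" "n \<ge> 1" "l > 0" and sing: "k i < 0"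
  shows "soliton_recursion (u 1) (u 2) (u 3) n Q (of_real l)"
proof -
  have lead: "u i 0 \<noteq> 0" for i using sol by (simp add: puiseux_solution_def)
  let ?X = "\<lambda>i. component_fls (k i) (u i)"
  have deg: "fls_subdegree (?X i) = k i" for i using component_fls_subdegree lead by blast
  have nz: "?X i \<noteq> 0" for i
  proof
    assume "?X i = 0"
    moreover have "?X i $$ k i \<noteq> 0" using lead by (simp add: component_fls_nth)
    ultimately show False by simp
  qed
  interpret soliton_laurent "?X 1" "?X 2" "?X 3" n Q "of_real l"
  proof
    show "of_int m * ?X 1 $$ m = of_nat Q * ((?X 1 * ?X 1) $$ (m - int Q) - (?X 1 * ?X 2) $$ (m - int Q)
           + of_real l * (?X 3 * ?X 3) $$ (m - int Q) + (if m = int Q then of_nat n - 1 else 0))" for m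
      by (rule soliton_laurent_equations(1)[OF sol \<open>Q > 0\<close>])
    show "of_int m * ?X 2 $$ m = of_nat Q * ((?X 1 * ?X 2) $$ (m - int Q) - of_nat n * (?X 1 * ?X 1) $$ (m - int Q)
           + of_real l * (?X 3 * ?X 3) $$ (m - int Q))" for m
      by (rule soliton_laurent_equations(2)[OF sol \<open>Q > 0\<close>])
    show "of_int m * ?X 3 $$ m = of_nat Q * (?X 1 * ?X 3) $$ (m - int Q)" for m
      by (rule soliton_laurent_equations(3)[OF sol \<open>Q > 0\<close>])
  qed (use assms nz in auto)
  have "k 1 < 0 \<or> k 2 < 0 \<or> k 3 < 0" using sing exhaust_3[of i] by auto
  hence k: "k 1 = - int Q" "k 2 = - int Q" "k 3 = - int Q"
    using all_orders_simple_pole unfolding deg by blast+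
  have "(\<lambda>j. component_fls (- int Q) a $$ (int j - int Q)) = a" for a
    by (simp add: component_fls_nth fun_eq_iff)
  moreover have "soliton_recursion (\<lambda>j. ?X 1 $$ (int j - int Q)) (\<lambda>j. ?X 2 $$ (int j - int Q))
      (\<lambda>j. ?X 3 $$ (int j - int Q)) n Q (of_real l)"
    by (rule soliton_recursion_of_laurent) (unfold deg, simp_all add: k)
  ultimately show ?thesis unfolding k by simp
qed

section \<open>One free coefficient at most\<close>

lemma resonance_unique:
  fixes s t n :: complex
  assumes "s\<^sup>2 - n * s - 2 * n = 0" "t\<^sup>2 - n * t - 2 * n = 0" "s \<noteq> t"
  shows "s * t = - 2 * n"
proof -
  have "(s - t) * (s + t - n) = 0" using assms(1,2) by algebra
  hence "n = s + t" using assms(3) by simp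
  thus ?thesis using assms(1) by algebra
qed

text \<open>The nontrivial factor of the resonance polynomial vanishes at the exponent \<open>j / Q\<close>.\<close>
definition resonant :: "nat \<Rightarrow> nat \<Rightarrow> nat \<Rightarrow> bool" where
  "resonant n Q j \<longleftrightarrow> j > 0 \<and>
     (of_nat j / of_nat Q)\<^sup>2 - of_nat n * (of_nat j / of_nat Q) - 2 * of_nat n = (0 :: complex)"

lemma resonant_unique:
  assumes "resonant n Q i" "resonant n Q j" "Q > 0"
  shows "i = j"
proof (rule ccontr)
  assume "i \<noteq> j"
  hence ne: "of_nat i / of_nat Q \<noteq> (of_nat j / of_nat Q :: complex)" using assms(3) by simp
  have "of_nat i / of_nat Q * (of_nat j / of_nat Q) = (- 2 * of_nat n :: complex)"
    by (rule resonance_unique[OF _ _ ne]) (use assms in \<open>simp_all add: resonant_def\<close>)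
  hence "of_nat (i * j + 2 * n * Q * Q) = (0 :: complex)" using assms(3) by (simp add: field_simps)
  hence "i * j = 0" unfolding of_nat_eq_0_iff by simp
  thus False using assms by (simp add: resonant_def)
qed

text \<open>
  With the leading coefficients fixed, step \<open>j\<close> of the recursion is uniquely solvable except at the single
  resonant index \<open>J\<close>, where only \<open>a J\<close> stays undetermined. The right-hand sides are polynomials in
  earlier coefficients, so everything is a polynomial in \<open>a J\<close>, the same one for all solutions.
  If there is no resonant index, \<open>J\<close> is arbitrary.
\<close>
lemma coeffs_polynomial_in_parameter:
  fixes l \<gamma> :: complex
  assumes "Q > 0" and J: "\<And>j. resonant n Q j \<Longrightarrow> j = J" and "\<gamma> \<noteq> 0"
  shows "\<exists>A B C. \<forall>a b c. soliton_recursion a b c n Q l \<and> c 0 = \<gamma> \<longrightarrow>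
           a j = poly A (a J) \<and> b j = poly B (a J) \<and> c j = poly C (a J)"
proof (induction j rule: less_induct)
  case (less j)
  show ?case
  proof (cases "j = 0")
    case True
    show ?thesis
    proof (intro exI allI impI)
      fix a b c assume "soliton_recursion a b c n Q l \<and> c 0 = \<gamma>"
      then interpret soliton_recursion a b c n Q l by simp
      from \<open>_ \<and> c 0 = \<gamma>\<close> show "a j = poly [:-1:] (a J) \<and> b j = poly [:- of_nat n:] (a J) \<and> c j = poly [:\<gamma>:] (a J)"
        using leading_coeffs(1,2) True \<open>\<gamma> \<noteq> 0\<close> by simp
    qed
  next
    case False
    \<comment> \<open>A name for the induction hypothesis, under which the polynomials are chosen simultaneously.\<close>
    define det where "det i A B C \<longleftrightarrow> (\<forall>a b c. soliton_recursion a b c n Q l \<and> c 0 = \<gamma> \<longrightarrow>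
        a i = poly A (a J) \<and> b i = poly B (a J) \<and> c i = poly C (a J))" for i A B C
    have "\<exists>A B C. det i A B C" if "i < j" for i
      using less.IH[OF that] unfolding det_def .
    then obtain A B C where det: "\<And>i. i < j \<Longrightarrow> det i (A i) (B i) (C i)"
      by metis
    have ABC: "a i = poly (A i) (a J) \<and> b i = poly (B i) (a J) \<and> c i = poly (C i) (a J)"
      if "i < j" "soliton_recursion a b c n Q l" "c 0 = \<gamma>" for i a b c
      using that det[of i] unfolding det_def by blast
    define s :: complex where "s = of_nat j / of_nat Q"
    define D where "D = (s + 1) * (s\<^sup>2 - of_nat n * s - 2 * of_nat n)"
    define R1 where "R1 = inner_conv A A j - inner_conv A B j + smult l (inner_conv C C j)
        + [:if j = 2 * Q then of_nat n - 1 else 0:]"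
    define R2 where "R2 = inner_conv A B j - smult (of_nat n) (inner_conv A A j) + smult l (inner_conv C C j)"
    define R3 where "R3 = inner_conv A C j"
    define Aj where "Aj = (if j = J then [:0, 1:]
        else smult (1 / D) (smult (s\<^sup>2) R1 + smult s R2 + smult (2 * l * \<gamma> * (1 + s)) R3))"
    define Cj where "Cj = smult (1 / s) (smult \<gamma> Aj + R3)"
    define Bj where "Bj = smult (1 / s) (smult (of_nat n) Aj + smult (2 * l * \<gamma>) Cj + R2)"
    have s: "s \<noteq> 0" using False \<open>Q > 0\<close> by (simp add: s_def)
    have s1: "s + 1 \<noteq> 0"
      using \<open>Q > 0\<close> of_nat_neq_0[of "j + Q - 1", where 'a = complex] by (simp add: s_def field_simps flip: of_nat_add)
    have D: "D \<noteq> 0" if "j \<noteq> J"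
      using J[of j] that s1 False unfolding D_def resonant_def s_def by auto
    show ?thesis
    proof (intro exI allI impI)
      fix a b c assume rec: "soliton_recursion a b c n Q l \<and> c 0 = \<gamma>"
      then interpret soliton_recursion a b c n Q l by simp
      have c0: "c 0 = \<gamma>" using rec by simp
      have i: "a i = poly (A i) (a J) \<and> b i = poly (B i) (a J) \<and> c i = poly (C i) (a J)" if "i < j" for i
        by (rule ABC[OF that rec[THEN conjunct1] rec[THEN conjunct2]])
      have conv: "inner_conv a a j = poly (inner_conv A A j) (a J)" "inner_conv a b j = poly (inner_conv A B j) (a J)"
        "inner_conv a c j = poly (inner_conv A C j) (a J)" "inner_conv c c j = poly (inner_conv C C j) (a J)"
        unfolding inner_conv_def by (auto intro!: sum.cong simp: poly_sum i)
      have "c 0 \<noteq> 0" "j > 0" using c0 \<open>\<gamma> \<noteq> 0\<close> False by auto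
      note H = higher_coeffs[OF this, folded s_def, unfolded conv c0]
      have Aj: "a j = poly Aj (a J)"
      proof (cases "j = J")
        case False
        have "D * a j = poly (smult (s\<^sup>2) R1 + smult s R2 + smult (2 * l * \<gamma> * (1 + s)) R3) (a J)"
          using H(3) by (simp add: D_def R1_def R2_def R3_def)
        thus ?thesis using D[OF False] False by (simp add: Aj_def field_simps)
      qed (simp add: Aj_def)
      have "s * c j = poly (smult \<gamma> Aj + R3) (a J)" using H(1) Aj by (simp add: R3_def)
      hence Cj: "c j = poly Cj (a J)" using s by (simp add: Cj_def field_simps)
      have "s * b j = poly (smult (of_nat n) Aj + smult (2 * l * \<gamma>) Cj + R2) (a J)"
        using H(2) Aj Cj by (simp add: R2_def)
      hence "b j = poly Bj (a J)" using s by (simp add: Bj_def field_simps)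
      with Aj Cj show "a j = poly Aj (a J) \<and> b j = poly Bj (a J) \<and> c j = poly Cj (a J)" by simp
    qed
  qed
qed

text \<open>
  A curve does not fill the plane: if \<open>v\<close> differs from every value taken by a constant \<open>f \<sigma>\<close>, then the line of
  points with first coordinate \<open>v\<close> meets each curve in finitely many points. It suffices to exclude the
  values of \<open>f \<sigma>\<close> at \<open>0\<close>, since these include the constant ones.
\<close>
lemma finite_polynomial_curves_miss_point:
  fixes f g :: "'i \<Rightarrow> complex poly"
  assumes "finite K"
  obtains v w where "v \<noteq> 0" "w \<noteq> 0" "\<And>\<sigma> x. \<sigma> \<in> K \<Longrightarrow> \<not> (poly (f \<sigma>) x = v \<and> poly (g \<sigma>) x = w)"
proof -
  have "finite (insert 0 ((\<lambda>\<sigma>. coeff (f \<sigma>) 0) ` K))" using assms by simp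
  then obtain v where v: "v \<notin> insert 0 ((\<lambda>\<sigma>. coeff (f \<sigma>) 0) ` K)"
    using ex_new_if_finite[OF infinite_UNIV_char_0] by blast
  have fin: "finite {x. poly (f \<sigma>) x = v}" if "\<sigma> \<in> K" for \<sigma>
  proof -
    have "coeff (f \<sigma>) 0 \<noteq> v" using v that by auto
    hence "f \<sigma> - [:v:] \<noteq> 0" by auto
    from poly_roots_finite[OF this] show ?thesis by simp
  qed
  have "finite (insert 0 (\<Union>\<sigma>\<in>K. poly (g \<sigma>) ` {x. poly (f \<sigma>) x = v}))"
    using assms fin by simp
  then obtain w where w: "w \<notin> insert 0 (\<Union>\<sigma>\<in>K. poly (g \<sigma>) ` {x. poly (f \<sigma>) x = v})"
    using ex_new_if_finite[OF infinite_UNIV_char_0] by blast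
  show thesis by (rule that[of v w]) (use v w in blast)+
qed

lemma soliton_coeff_polynomial:
  fixes l :: real and i :: 3
  assumes "Q > 0" "n \<ge> 1" "l > 0" and J: "\<And>j. resonant n Q j \<Longrightarrow> j = J" and "\<gamma> \<noteq> 0"
  shows "\<exists>A. \<forall>k t0 u. puiseux_solution (soliton_system n l) Q k t0 u \<and> (\<exists>i. k i < 0) \<and> u 3 0 = \<gamma>
           \<longrightarrow> u i j = poly A (u 1 J)"
proof -
  obtain A B C where ABC: "\<And>a b c. soliton_recursion a b c n Q (of_real l) \<Longrightarrow> c 0 = \<gamma> \<Longrightarrow>
      a j = poly A (a J) \<and> b j = poly B (a J) \<and> c j = poly C (a J)"
    using coeffs_polynomial_in_parameter[OF \<open>Q > 0\<close> J \<open>\<gamma> \<noteq> 0\<close>, where l = "of_real l" and j = j] by blast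
  have "u 1 j = poly A (u 1 J) \<and> u 2 j = poly B (u 1 J) \<and> u 3 j = poly C (u 1 J)"
    if "puiseux_solution (soliton_system n l) Q k t0 u" "\<exists>i. k i < 0" "u 3 0 = \<gamma>" for k t0 u
    using that soliton_recursion_of_puiseux_solution[OF that(1) assms(1-3)] ABC[of "u 1" "u 2" "u 3"] by blast
  thus ?thesis using exhaust_3[of i] by blast
qed

section \<open>Failure of the test\<close>

theorem theorem3p3:
  fixes l :: real and n :: nat
  assumes "l > 0" and "n \<ge> 1"
  shows "\<not> weak_painleve_test (soliton_system n l) \<and> \<not> strong_painleve_test (soliton_system n l)"
proof -
  have "\<not> painleve_family (soliton_system n l) Q" if "Q > 0" for Q
  proof
    assume "painleve_family (soliton_system n l) Q"
    then obtain k P F where k: "\<exists>i. k i < 0" and card: "card (P :: (3 \<times> nat) set) = 2"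
      and F: "\<forall>(t0, u) \<in> F. puiseux_solution (soliton_system n l) Q k t0 u"
      and free: "\<forall>t0. \<forall>p. (\<forall>i. (i, 0) \<in> P \<longrightarrow> p (i, 0) \<noteq> 0) \<longrightarrow>
           (let M = {u. (t0, u) \<in> F \<and> (\<forall>(i, j) \<in> P. u i j = p (i, j))} in M \<noteq> {} \<and> finite M)"
      unfolding painleve_family_def by (elim exE conjE) (rule that, erule exI, simp, assumption, assumption)
    obtain x y where P: "P = {x, y}" "x \<noteq> y" using card by (auto simp: card_2_iff)
    \<comment> \<open>If no index is resonant, the choice returns some arbitrary \<open>J\<close>, which is harmless.\<close>
    define J where "J = (SOME j. resonant n Q j)"
    have J: "j = J" if "resonant n Q j" for j
      unfolding J_def by (rule resonant_unique[OF that someI[of "resonant n Q"] \<open>Q > 0\<close>]) (rule that)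
    \<comment> \<open>The leading coefficient of \<open>z\<close> satisfies \<open>l c ^ 2 = n\<close>, which leaves the two values \<open>\<gamma>\<close> and \<open>-\<gamma>\<close>.\<close>
    define \<gamma> where "\<gamma> = csqrt (of_nat n / of_real l)"
    have \<gamma>: "\<gamma> \<noteq> 0" using assms by (simp add: \<gamma>_def)
    define det where "det \<sigma> i j A \<longleftrightarrow> (\<forall>k t0 u. puiseux_solution (soliton_system n l) Q k t0 u
        \<and> (\<exists>i. k i < 0) \<and> u 3 0 = \<sigma> \<longrightarrow> u i j = poly A (u 1 J))" for \<sigma> i j A
    have "\<exists>A. det \<sigma> i j A" if "\<sigma> \<in> {\<gamma>, - \<gamma>}" for \<sigma> i j
      unfolding det_def by (rule soliton_coeff_polynomial) (use assms J \<gamma> that \<open>Q > 0\<close> in auto)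
    then obtain A where A: "\<And>\<sigma> i j. \<sigma> \<in> {\<gamma>, - \<gamma>} \<Longrightarrow> det \<sigma> i j (A \<sigma> i j)"
      by metis
    obtain v w where vw: "v \<noteq> 0" "w \<noteq> 0" "\<And>\<sigma> \<theta>. \<sigma> \<in> {\<gamma>, - \<gamma>} \<Longrightarrow>
        \<not> (poly (A \<sigma> (fst x) (snd x)) \<theta> = v \<and> poly (A \<sigma> (fst y) (snd y)) \<theta> = w)"
      using finite_polynomial_curves_miss_point[of "{\<gamma>, - \<gamma>}"
          "\<lambda>\<sigma>. A \<sigma> (fst x) (snd x)" "\<lambda>\<sigma>. A \<sigma> (fst y) (snd y)"] by auto
    \<comment> \<open>Both values are nonzero, so they may be prescribed even at positions of leading coefficients.\<close>
    let ?val = "\<lambda>z. if z = x then v else w"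
    have "\<forall>i. (i, 0) \<in> P \<longrightarrow> ?val (i, 0) \<noteq> 0" using vw(1,2) by simp
    from free[THEN spec, THEN spec, THEN mp, OF this]
    obtain u where u: "(0, u) \<in> F" "\<forall>(i, j)\<in>P. u i j = ?val (i, j)"
      unfolding Let_def by blast
    have sol: "puiseux_solution (soliton_system n l) Q k 0 u" using F u(1) by blast
    obtain i where "k i < 0" using k by blast
    then interpret soliton_recursion "u 1" "u 2" "u 3" n Q "of_real l"
      using soliton_recursion_of_puiseux_solution[OF sol \<open>Q > 0\<close> assms(2,1)] by blast
    have "u 3 0 \<noteq> 0" using sol by (simp add: puiseux_solution_def)
    hence "of_real l * (u 3 0)\<^sup>2 = of_nat n" by (rule leading_coeffs)
    moreover have "\<gamma>\<^sup>2 = of_nat n / of_real l" unfolding \<gamma>_def by (rule power2_csqrt)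
    ultimately have "of_real l * (u 3 0)\<^sup>2 = of_real l * \<gamma>\<^sup>2" using assms(1) by simp
    hence "(u 3 0)\<^sup>2 = \<gamma>\<^sup>2" using assms(1) by simp
    hence "u 3 0 \<in> {\<gamma>, - \<gamma>}" by (simp add: power2_eq_iff)
    hence poly: "u i j = poly (A (u 3 0) i j) (u 1 J)" for i j
      using A sol k unfolding det_def by blast
    have "u (fst x) (snd x) = v" "u (fst y) (snd y) = w" using u(2) P by (auto simp: split_def)
    hence "poly (A (u 3 0) (fst x) (snd x)) (u 1 J) = v" "poly (A (u 3 0) (fst y) (snd y)) (u 1 J) = w"
      by (blast intro: trans[OF poly[symmetric]])+
    thus False using vw(3)[OF \<open>u 3 0 \<in> {\<gamma>, - \<gamma>}\<close>] by blast
  qed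
  thus ?thesis using strong_imp_weak_painleve_test unfolding weak_painleve_test_def by blast
qed

end
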